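(* Let $n\geq 1$ be an integer. Then \[ \dim_F \mathrm{Bad}(n)\leq \frac{2n}{n+1}. \]
   Context: For a Borel probability measure $\mu$ on $\mathbb{R}^n$, $\hat\mu(\xi)=\int e^{-2\pi i x\cdot\xi}\,d\mu(x)$ and $\dim_F\mu=\sup\{s\in[0,n]: |\hat\mu(\xi)|\ll|\xi|^{-s/2}\}$. For $E\subset\mathbb{R}^n$, $\dim_F E=\sup\{\dim_F\mu:\mu\in\mathcal P(E)\}$, where $\mathcal P(E)$ is the set of Borel probability measures on $\mathbb{R}^n$ whose support is a compact subset of $E$. For $x\in\mathbb{R}^n$, $\|x\|$ denotes the Euclidean distance from $x$ to the nearest point of $\mathbb{Z}^n$. The set of badly approximable vectors is \[ \mathrm{Bad}(n)=\{x\in\mathbb{R}^n:\exists c(x)>0\ \forall q\in\mathbb{N},\ \|qx\|\geq c(x)q^{-1/n}\}. \] *)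

theory Defs
  imports "HOL-Probability.Probability"
begin

definition fourier_transform :: "(real ^ 'n) measure \<Rightarrow> real ^ 'n \<Rightarrow> complex" where
  "fourier_transform \<mu> \<xi> =
     (\<integral>x. exp (- 2 * complex_of_real pi * \<i> * complex_of_real (x \<bullet> \<xi>)) \<partial>\<mu>)"

(* The frequency \<xi> = 0 is excluded because 0 powr a = 0, whereas the decay bound is void there.
   For a probability measure the set always contains s = 0, so the real supremum is proper. *)
definition fourier_dim_measure :: "(real ^ 'n) measure \<Rightarrow> real" where
  "fourier_dim_measure \<mu> =
     Sup {s \<in> {0..real CARD('n)}.
            \<exists>C. \<forall>\<xi>. \<xi> \<noteq> 0 \<longrightarrow> norm (fourier_transform \<mu> \<xi>) \<le> C * norm \<xi> powr (- s / 2)}"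

definition measure_support :: "'a::topological_space measure \<Rightarrow> 'a set" where
  "measure_support \<mu> = {x. \<forall>U. open U \<and> x \<in> U \<longrightarrow> emeasure \<mu> U > 0}"

definition compact_prob_measures :: "'a::topological_space set \<Rightarrow> 'a measure set" where
  "compact_prob_measures E =
     {\<mu>. prob_space \<mu> \<and> sets \<mu> = sets borel \<and>
         compact (measure_support \<mu>) \<and> measure_support \<mu> \<subseteq> E}"

(* Taking the supremum in ennreal gives the usual convention that the empty set has dimension 0. *)
definition fourier_dim :: "(real ^ 'n) set \<Rightarrow> ennreal" where
  "fourier_dim E = (SUP \<mu> \<in> compact_prob_measures E. ennreal (fourier_dim_measure \<mu>))"

definition int_lattice :: "(real ^ 'n) set" where
  "int_lattice = {z. \<forall>i. z $ i \<in> \<int>}"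

definition nearest_int_dist :: "real ^ 'n \<Rightarrow> real" where
  "nearest_int_dist x = infdist x int_lattice"

definition Bad :: "(real ^ 'n) set" where
  "Bad = {x. \<exists>c>0. \<forall>q::nat. q \<ge> 1 \<longrightarrow>
            nearest_int_dist (real q *\<^sub>R x) \<ge> c * real q powr (- 1 / real CARD('n))}"

end

theory Submission
  imports Defs
begin

text \<open>
  Suppose \<open>\<mu>\<close> is supported on a compact subset of \<open>Bad\<close> and \<open>\<bar>\<mu>^(\<xi>)\<bar> \<le> C \<bar>\<xi>\<bar>^(-a)\<close> with
  \<open>a > n / (n + 1)\<close>. By Baire, a nonempty relatively open part \<open>U\<close> of the support consists of points
  whose badly-approximable constant is at least a single \<open>c > 0\<close>.

  Take \<open>q = m^n\<close> and a trigonometric polynomial \<open>S\<close> on the torus with frequencies in a box of side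
  \<open>L\<close> comparable to \<open>m\<close> and unit \<open>L2\<close> norm. In the integral of \<open>e(\<eta>.x) \<bar>S(q x)\<bar>^2\<close> against
  \<open>\<mu>\<close>, the off-diagonal terms contribute \<open>O(q^(-a) L^(n - a)) = O(m^(n - a (n + 1)))\<close>, which tends
  to 0. Hence \<open>\<bar>S(q x)\<bar>^2 \<mu>\<close> converges weakly to \<open>\<mu>\<close>.

  For \<open>S\<close> a product of tent-coefficient polynomials, the weights
  \<open>\<bar>1 - e(q x_i)\<bar>^2 \<bar>S(q x)\<bar>^2\<close> are again squares of trigonometric polynomials (differences of the
  coefficients), of mean \<open>O(1 / L^2)\<close>. On \<open>U\<close> the sum over \<open>i\<close> of \<open>\<bar>1 - e(q x_i)\<bar>^2\<close> is at least
  \<open>16 (c / m)^2\<close>. When \<open>L / m\<close> is a large constant, integrating against a bump function on \<open>U\<close>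
  yields that its integral is at most half of itself, a contradiction.
\<close>

section \<open>Characters, supports and integrability\<close>

definition char_fun :: "real ^ 'n \<Rightarrow> real ^ 'n \<Rightarrow> complex" where
  "char_fun \<eta> x = cis (2 * pi * (\<eta> \<bullet> x))"

lemma norm_char_fun [simp]: "norm (char_fun \<eta> x) = 1"
  by (simp add: char_fun_def)

lemma char_fun_0 [simp]: "char_fun 0 x = 1"
  by (simp add: char_fun_def)

lemma cnj_char_fun: "cnj (char_fun \<eta> x) = char_fun (- \<eta>) x"
  by (simp add: char_fun_def cis_cnj)

lemma char_fun_add: "char_fun (\<eta> + \<zeta>) x = char_fun \<eta> x * char_fun \<zeta> x"
  by (simp add: char_fun_def cis_mult inner_add_left algebra_simps)

lemma continuous_on_char_fun: "continuous_on A (char_fun \<eta>)"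
  unfolding char_fun_def by (intro continuous_intros)

lemma fourier_transform_char_fun: "fourier_transform \<mu> \<xi> = (\<integral>x. char_fun (- \<xi>) x \<partial>\<mu>)"
  by (simp add: fourier_transform_def char_fun_def cis_conv_exp inner_commute mult_ac)

text \<open>By the Lindelof property the complement of the support, a union of null open sets, is
  already a union of countably many of them.\<close>

lemma AE_in_measure_support:
  fixes \<mu> :: "'a::second_countable_topology measure"
  assumes sets: "sets \<mu> = sets borel"
  shows "AE x in \<mu>. x \<in> measure_support \<mu>"
proof -
  define \<F> where "\<F> = {U. open U \<and> emeasure \<mu> U = 0}"
  obtain \<F>' where \<F>': "\<F>' \<subseteq> \<F>" "countable \<F>'" "\<Union>\<F>' = \<Union>\<F>"
    using Lindelof[of \<F>] by (auto simp: \<F>_def)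
  have "(\<Union>U\<in>\<F>'. U) \<in> null_sets \<mu>"
    using \<F>' by (intro null_sets_UN') (auto simp: \<F>_def null_sets_def sets)
  moreover have "{x \<in> space \<mu>. x \<notin> measure_support \<mu>} \<subseteq> (\<Union>U\<in>\<F>'. U)"
    using \<F>'(3) by (auto simp: \<F>_def measure_support_def)
  ultimately show ?thesis
    by (intro AE_I') auto
qed

lemma integrable_bounded_continuous:
  fixes f :: "'a::topological_space \<Rightarrow> 'b::{second_countable_topology, banach}"
  assumes "prob_space \<mu>" "sets \<mu> = sets borel" "continuous_on UNIV f" "\<And>x. norm (f x) \<le> B"
  shows "integrable \<mu> f"
proof -
  interpret prob_space \<mu> by fact
  have "f \<in> borel_measurable \<mu>"
    using borel_measurable_continuous_onI[OF assms(3)] assms(2)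
    by (simp cong: measurable_cong_sets)
  then show ?thesis
    using assms(4) by (intro integrable_const_bound[where B=B]) auto
qed

subsection \<open>Trigonometric polynomials and weak convergence\<close>

text \<open>Frequencies run over all of \<open>real ^ 'n\<close>, not only over the lattice, so
  these functions separate the points of the whole space and Stone-Weierstrass applies on every
  compact set.\<close>

inductive_set trig_poly :: "(real ^ 'n \<Rightarrow> complex) set" where
  char: "char_fun \<eta> \<in> trig_poly"
| scale: "f \<in> trig_poly \<Longrightarrow> (\<lambda>x. c * f x) \<in> trig_poly"
| add: "f \<in> trig_poly \<Longrightarrow> g \<in> trig_poly \<Longrightarrow> (\<lambda>x. f x + g x) \<in> trig_poly"

lemma trig_poly_char_mult:
  assumes "g \<in> trig_poly" shows "(\<lambda>x. char_fun \<eta> x * g x) \<in> trig_poly"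
  using assms
proof induction
  case (char \<zeta>)
  show ?case using trig_poly.char[of "\<eta> + \<zeta>"] by (simp add: char_fun_add[abs_def])
next
  case (scale f c)
  show ?case using trig_poly.scale[OF scale.IH, of c] by (simp add: mult_ac)
next
  case (add f g)
  show ?case using trig_poly.add[OF add.IH] by (simp add: algebra_simps)
qed

lemma trig_poly_mult:
  assumes "f \<in> trig_poly" "g \<in> trig_poly" shows "(\<lambda>x. f x * g x) \<in> trig_poly"
  using assms(1)
proof induction
  case (char \<zeta>)
  show ?case by (rule trig_poly_char_mult) fact
next
  case (scale f c)
  show ?case using trig_poly.scale[OF scale.IH, of c] by (simp add: mult_ac)
next
  case (add f g)
  show ?case using trig_poly.add[OF add.IH] by (simp add: algebra_simps)
qed

lemma trig_poly_continuous_bounded: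
  assumes "f \<in> trig_poly" shows "continuous_on UNIV f \<and> (\<exists>B. \<forall>x. norm (f x) \<le> B)"
  using assms
proof induction
  case (char \<zeta>)
  show ?case by (auto intro: continuous_on_char_fun)
next
  case (scale f c)
  then obtain B where "\<forall>x. norm (f x) \<le> B" by auto
  then have "\<forall>x. norm (c * f x) \<le> norm c * B"
    by (auto simp: norm_mult intro!: mult_left_mono)
  with scale show ?case by (auto intro!: continuous_intros)
next
  case (add f g)
  then obtain B C where "\<forall>x. norm (f x) \<le> B" "\<forall>x. norm (g x) \<le> C" by auto
  then have "\<forall>x. norm (f x + g x) \<le> B + C"
    by (meson norm_triangle_mono)
  with add show ?case by (auto intro!: continuous_intros)
qed

text \<open>The real Stone-Weierstrass theorem asks for a real-valued function, hence a sine instead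
  of a single character. Its phase makes it vanish at \<open>y\<close>, and \<eta> is scaled so that
  \<open>x\<close> lies a quarter period further, where the sine is 1.\<close>

lemma trig_poly_separates_points:
  fixes x y :: "real ^ 'n"
  assumes "x \<noteq> y"
  shows "\<exists>f. (\<lambda>z. complex_of_real (f z)) \<in> trig_poly \<and> f x \<noteq> f y"
proof -
  define \<eta> where "\<eta> = (1 / (4 * ((x - y) \<bullet> (x - y)))) *\<^sub>R (x - y)"
  define f where "f z = sin (2 * pi * (\<eta> \<bullet> (z - y)))" for z
  define c where "c = cis (- 2 * pi * (\<eta> \<bullet> y))"
  have f: "complex_of_real (f z) = c / (2 * \<i>) * char_fun \<eta> z + (- cnj c / (2 * \<i>)) * char_fun (- \<eta>) z" for z
  proof -
    have "c * char_fun \<eta> z = cis (2 * pi * (\<eta> \<bullet> (z - y)))"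
      by (simp add: c_def char_fun_def cis_mult inner_diff_right algebra_simps)
    moreover have "cnj c * char_fun (- \<eta>) z = cis (- (2 * pi * (\<eta> \<bullet> (z - y))))"
      by (simp add: c_def char_fun_def cis_mult cis_cnj inner_diff_right algebra_simps)
    ultimately have "c * char_fun \<eta> z - cnj c * char_fun (- \<eta>) z = 2 * \<i> * f z"
      by (simp add: complex_eq_iff f_def)
    then show ?thesis by (simp add: field_simps)
  qed
  have "(\<lambda>z. complex_of_real (f z)) \<in> trig_poly"
    unfolding f by (intro trig_poly.intros)
  moreover have "f x = 1"
  proof -
    have "\<eta> \<bullet> (x - y) = 1 / 4" using assms by (simp add: \<eta>_def)
    then have "2 * pi * (\<eta> \<bullet> (x - y)) = pi / 2" by simp
    then show ?thesis by (simp only: f_def sin_pi_half)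
  qed
  moreover have "f y = 0" by (simp add: f_def)
  ultimately show ?thesis by (intro exI[of _ f]) auto
qed

lemma trig_poly_dense:
  fixes f :: "real ^ 'n \<Rightarrow> real"
  assumes "compact K" "continuous_on K f" "e > 0"
  obtains g where "(\<lambda>x. complex_of_real (g x)) \<in> trig_poly" "\<And>x. x \<in> K \<Longrightarrow> \<bar>f x - g x\<bar> < e"
proof -
  define R where "R = {g :: real ^ 'n \<Rightarrow> real. (\<lambda>x. complex_of_real (g x)) \<in> trig_poly}"
  interpret function_ring_on R K
  proof
    show "compact K" by fact
    show "continuous_on K g" if "g \<in> R" for g
    proof -
      have "continuous_on UNIV (\<lambda>x. complex_of_real (g x))"
        using that trig_poly_continuous_bounded[of "\<lambda>x. complex_of_real (g x)"]
        unfolding R_def mem_Collect_eq by blast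
      then have "continuous_on UNIV (\<lambda>x. Re (complex_of_real (g x)))"
        by (rule continuous_on_Re)
      then show ?thesis by (auto intro: continuous_on_subset)
    qed
    show "(\<lambda>x. g x + h x) \<in> R" if "g \<in> R" "h \<in> R" for g h
      using that trig_poly.add by (auto simp: R_def)
    show "(\<lambda>x. g x * h x) \<in> R" if "g \<in> R" "h \<in> R" for g h
      using that trig_poly_mult by (auto simp: R_def)
    show "(\<lambda>_. c) \<in> R" for c
      using trig_poly.scale[OF trig_poly.char[of 0], of c] by (simp add: R_def)
    show "\<exists>g\<in>R. g x \<noteq> g y" if "x \<noteq> y" for x y
      using trig_poly_separates_points[OF that] by (auto simp: R_def)
  qed
  show ?thesis
    using Stone_Weierstrass_basic[OF assms(2,3)] that by (auto simp: R_def)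
qed

text \<open>Replacing \<open>f\<close> on \<open>K\<close> by a nearby trigonometric polynomial
  costs a small multiple of the mass of \<open>h m\<close>, and the character of frequency 0 keeps
  that mass bounded. The conclusion is about a difference because \<open>\<theta> m\<close> need not
  converge. The bound \<open>B m\<close> may grow with \<open>m\<close>; it serves
  integrability.\<close>

lemma tendsto_integral_continuous_if_characters:
  fixes \<mu> :: "(real ^ 'n) measure" and h :: "nat \<Rightarrow> real ^ 'n \<Rightarrow> real"
  assumes \<mu>: "prob_space \<mu>" "sets \<mu> = sets borel"
    and K: "compact K" "AE x in \<mu>. x \<in> K"
    and h: "\<And>m. continuous_on UNIV (h m)" "\<And>m x. 0 \<le> h m x" "\<And>m x. h m x \<le> B m"
    and \<theta>: "\<And>m. 0 \<le> \<theta> m" "\<And>m. \<theta> m \<le> 1"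
    and chars: "\<And>\<eta>. (\<lambda>m. (\<integral>x. char_fun \<eta> x * h m x \<partial>\<mu>) - \<theta> m * (\<integral>x. char_fun \<eta> x \<partial>\<mu>)) \<longlonglongrightarrow> 0"
    and f: "continuous_on UNIV f" "\<And>x. \<bar>f x\<bar> \<le> D"
  shows "(\<lambda>m. (\<integral>x. f x * h m x \<partial>\<mu>) - \<theta> m * (\<integral>x. f x \<partial>\<mu>)) \<longlonglongrightarrow> 0"
proof -
  interpret prob_space \<mu> by fact
  note int = integrable_bounded_continuous[OF \<mu>]
  have int_h: "integrable \<mu> (h m)" for m
    using h by (intro int[where B="B m"]) auto
  have int_trig: "integrable \<mu> P" "integrable \<mu> (\<lambda>x. P x * h m x)" if P: "P \<in> trig_poly"
    for P :: "real ^ 'n \<Rightarrow> complex" and m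
  proof -
    obtain C where C: "continuous_on UNIV P" "\<And>x. norm (P x) \<le> C"
      using trig_poly_continuous_bounded[OF P] by auto
    show "integrable \<mu> P" using C by (rule int)
    have "norm (P x * h m x) \<le> C * B m" for x
      using C(2)[of x] h(2,3)[of m x] order_trans[OF norm_ge_zero C(2)]
      by (auto simp: norm_mult intro!: mult_mono)
    then show "integrable \<mu> (\<lambda>x. P x * h m x)"
      using C(1) h(1) by (intro int) (auto intro!: continuous_intros)
  qed
  have trig: "(\<lambda>m. (\<integral>x. P x * h m x \<partial>\<mu>) - \<theta> m * (\<integral>x. P x \<partial>\<mu>)) \<longlonglongrightarrow> 0" if "P \<in> trig_poly"
    for P :: "real ^ 'n \<Rightarrow> complex"
    using that
  proof induction
    case (char \<eta>)
    show ?case by (rule chars)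
  next
    case (scale P c)
    have "(\<lambda>m. c * ((\<integral>x. P x * h m x \<partial>\<mu>) - \<theta> m * (\<integral>x. P x \<partial>\<mu>))) \<longlonglongrightarrow> 0"
      using scale.IH by (rule tendsto_mult_right_zero)
    then show ?case by (simp add: algebra_simps)
  next
    case (add P Q)
    from tendsto_add[OF add.IH] show ?case
      using add.hyps int_trig by (simp add: algebra_simps)
  qed
  have trig_real: "(\<lambda>m. (\<integral>x. g x * h m x \<partial>\<mu>) - \<theta> m * (\<integral>x. g x \<partial>\<mu>)) \<longlonglongrightarrow> 0"
    if "(\<lambda>x. complex_of_real (g x)) \<in> trig_poly" for g
  proof -
    have "(\<lambda>m. complex_of_real ((\<integral>x. g x * h m x \<partial>\<mu>) - \<theta> m * (\<integral>x. g x \<partial>\<mu>))) \<longlonglongrightarrow> complex_of_real 0"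
      using trig[OF that] by (simp flip: of_real_mult)
    then show ?thesis by (simp only: tendsto_of_real_iff)
  qed
  show ?thesis
  proof (rule LIMSEQ_I)
    fix e :: real assume "e > 0"
    obtain g where g: "(\<lambda>x. complex_of_real (g x)) \<in> trig_poly" "\<And>x. x \<in> K \<Longrightarrow> \<bar>f x - g x\<bar> < e / 4"
      using trig_poly_dense[OF K(1), of f "e / 4"] f(1) \<open>e > 0\<close> by (auto intro: continuous_on_subset)
    \<comment> \<open>The constant 1 is a trigonometric polynomial, and its case of the limit
      controls the total mass of \<open>h m\<close>.\<close>
    have "(\<lambda>x. complex_of_real (1::real)) \<in> (trig_poly :: (real ^ 'n \<Rightarrow> complex) set)"
      using trig_poly.scale[OF trig_poly.char[of 0], of 1] by simp
    from trig_real[OF this] have lim1: "(\<lambda>m. (\<integral>x. h m x \<partial>\<mu>) - \<theta> m) \<longlonglongrightarrow> 0"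
      using prob_space by simp
    obtain N1 where N1: "\<And>m. m \<ge> N1 \<Longrightarrow> \<bar>(\<integral>x. h m x \<partial>\<mu>) - \<theta> m\<bar> < 1"
      using LIMSEQ_D[OF lim1, of 1] by auto
    obtain N2 where N2: "\<And>m. m \<ge> N2 \<Longrightarrow> \<bar>(\<integral>x. g x * h m x \<partial>\<mu>) - \<theta> m * (\<integral>x. g x \<partial>\<mu>)\<bar> < e / 4"
      using LIMSEQ_D[OF trig_real[OF g(1)], of "e / 4"] \<open>e > 0\<close> by auto
    have int_g: "integrable \<mu> g"
      using int_trig(1)[OF g(1)] by (simp add: complex_of_real_integrable_eq)
    have int_gh: "integrable \<mu> (\<lambda>x. g x * h m x)" for m
      using int_trig(2)[OF g(1), of m] by (simp add: complex_of_real_integrable_eq flip: of_real_mult)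
    have int_f: "integrable \<mu> f" using f by (intro int) auto
    have "norm (f x * h m x) \<le> D * B m" for x m
      using f(2)[of x] h(2,3)[of m x] order_trans[OF abs_ge_zero f(2)]
      by (auto simp: abs_mult intro!: mult_mono)
    then have int_fh: "integrable \<mu> (\<lambda>x. f x * h m x)" for m
      using f(1) h(1) by (intro int) (auto intro!: continuous_intros)
    show "\<exists>N. \<forall>m\<ge>N. norm ((\<integral>x. f x * h m x \<partial>\<mu>) - \<theta> m * (\<integral>x. f x \<partial>\<mu>) - 0) < e"
    proof (intro exI[of _ "max N1 N2"] allI impI)
      fix m assume m: "m \<ge> max N1 N2"
      have "\<bar>\<integral>x. (f x - g x) * h m x \<partial>\<mu>\<bar> \<le> (\<integral>x. e / 4 * h m x \<partial>\<mu>)"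
      proof -
        have "AE x in \<mu>. norm ((f x - g x) * h m x) \<le> e / 4 * h m x"
          using K(2)
        proof eventually_elim
          case (elim x)
          then show ?case
            using g(2)[of x] h(2)[of m x] mult_right_mono[of "\<bar>f x - g x\<bar>" "e / 4" "h m x"]
            by (simp add: abs_mult)
        qed
        then have "(\<integral>x. norm ((f x - g x) * h m x) \<partial>\<mu>) \<le> (\<integral>x. e / 4 * h m x \<partial>\<mu>)"
          using int_h[of m] int_fh[of m] int_gh[of m]
          by (intro integral_mono_AE integrable_norm) (auto simp: left_diff_distrib)
        from order_trans[OF integral_norm_bound this] show ?thesis by simp
      qed
      \<comment> \<open>The mass of \<open>h m\<close> is within 1 of \<open>\<theta> m\<close>,
        which is at most 1.\<close>
      also have "\<dots> \<le> e / 4 * 2"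
        using N1[of m] m \<theta>(2)[of m] \<open>e > 0\<close> by (auto intro!: mult_left_mono)
      finally have 1: "\<bar>(\<integral>x. f x * h m x \<partial>\<mu>) - (\<integral>x. g x * h m x \<partial>\<mu>)\<bar> \<le> e / 2"
        using int_fh int_gh by (simp add: left_diff_distrib)
      have "\<bar>\<integral>x. g x - f x \<partial>\<mu>\<bar> \<le> (\<integral>x. \<bar>g x - f x\<bar> \<partial>\<mu>)"
        by (rule integral_abs_bound)
      also have "\<dots> \<le> (\<integral>x. e / 4 \<partial>\<mu>)"
        using K(2) int_f int_g by (intro integral_mono_AE) (auto simp: abs_minus_commute dest!: g(2) elim!: eventually_mono)
      finally have "\<bar>(\<integral>x. g x \<partial>\<mu>) - (\<integral>x. f x \<partial>\<mu>)\<bar> \<le> e / 4"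
        using int_f int_g prob_space by simp
      then have "\<theta> m * \<bar>(\<integral>x. g x \<partial>\<mu>) - (\<integral>x. f x \<partial>\<mu>)\<bar> \<le> 1 * (e / 4)"
        using \<theta>[of m] by (intro mult_mono) auto
      then have 2: "\<bar>\<theta> m * (\<integral>x. g x \<partial>\<mu>) - \<theta> m * (\<integral>x. f x \<partial>\<mu>)\<bar> \<le> e / 4"
        using \<theta>[of m] by (simp add: abs_mult flip: right_diff_distrib)
      show "norm ((\<integral>x. f x * h m x \<partial>\<mu>) - \<theta> m * (\<integral>x. f x \<partial>\<mu>) - 0) < e"
        using 1 2 N2[of m] m unfolding real_norm_def by linarith
    qed
  qed
qed

subsection \<open>Equidistribution of product kernels\<close>

text \<open>The weight \<open>L powr (1 / 2 - b)\<close> reduces every exponent to 1/2, where the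
  sum telescopes against \<open>3 * sqrt L\<close>; so the constant does not depend on
  \<open>b\<close>. The maximum covers coordinates that coincide, at distance 0.\<close>

lemma sum_powr_minus_le:
  assumes "0 \<le> b" "b \<le> 1 / 2"
  shows "(\<Sum>j<L. max 1 (real j) powr (- b)) \<le> 3 * real L powr (1 - b)"
proof (cases "L = 0")
  case False
  have half: "(\<Sum>j<L. max 1 (real j) powr (- 1 / 2)) \<le> 3 * sqrt (real L)"
  proof (induction L)
    case (Suc L)
    have "max 1 (real L) powr (- 1 / 2) \<le> 3 * sqrt (real (Suc L)) - 3 * sqrt (real L)"
    proof (cases "L = 0")
      case False
      define u v where "u = sqrt (real L)" and "v = sqrt (real L + 1)"
      have uv: "u > 0" "v > 0" "v\<^sup>2 = u\<^sup>2 + 1" "u\<^sup>2 \<ge> 1"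
        using False by (auto simp: u_def v_def)
      \<comment> \<open>Source of the constant 3: then \<open>v + u\<close> is at most
        \<open>3 * u\<close>, while \<open>(v - u) * (v + u) = 1\<close>.\<close>
      have "v \<le> 2 * u"
        by (rule power2_le_imp_le) (use uv in \<open>auto simp: power_mult_distrib\<close>)
      moreover have "u \<le> v" by (simp add: u_def v_def)
      ultimately have "(v - u) * (v + u) \<le> (v - u) * (3 * u)"
        by (intro mult_left_mono) auto
      moreover have "(v - u) * (v + u) = 1"
        using uv by (simp add: algebra_simps power2_eq_square)
      ultimately have "1 / u \<le> 3 * v - 3 * u"
        using uv by (simp add: field_simps)
      moreover have "max 1 (real L) powr (- 1 / 2) = 1 / u"
        using False powr_minus[of "real L" "1 / 2"] by (simp add: u_def powr_half_sqrt inverse_eq_divide)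
      ultimately show ?thesis by (simp add: u_def v_def add.commute)
    qed simp
    with Suc show ?case by simp
  qed simp
  have "max 1 (real j) powr (- b) \<le> real L powr (1 / 2 - b) * max 1 (real j) powr (- 1 / 2)" if "j < L" for j
  proof -
    have "max 1 (real j) powr (- b) = max 1 (real j) powr (1 / 2 - b) * max 1 (real j) powr (- 1 / 2)"
      by (simp flip: powr_add)
    also have "\<dots> \<le> real L powr (1 / 2 - b) * max 1 (real j) powr (- 1 / 2)"
      using that assms by (intro mult_right_mono powr_mono2) auto
    finally show ?thesis .
  qed
  then have "(\<Sum>j<L. max 1 (real j) powr (- b)) \<le> (\<Sum>j<L. real L powr (1 / 2 - b) * max 1 (real j) powr (- 1 / 2))"
    by (intro sum_mono) auto
  also have "\<dots> \<le> real L powr (1 / 2 - b) * (3 * real L powr (1 / 2))"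
    using half False unfolding sum_distrib_left[symmetric]
    by (intro mult_left_mono) (auto simp: powr_half_sqrt)
  also have "\<dots> = 3 * real L powr (1 - b)"
    by (simp flip: powr_add)
  finally show ?thesis .
qed simp

text \<open>Each distance occurs at most twice, once on either side of \<open>k\<close>.\<close>

lemma sum_nat_dist_le:
  fixes w :: "real \<Rightarrow> real"
  assumes "\<And>t. 0 \<le> w t" "k < L"
  shows "(\<Sum>l<L. w \<bar>real k - real l\<bar>) \<le> 2 * (\<Sum>j<L. w (real j))"
proof -
  have "{..<L} = {..k} \<union> {k<..<L}" using assms(2) by auto
  then have "(\<Sum>l<L. w \<bar>real k - real l\<bar>)
      = (\<Sum>l\<in>{..k}. w \<bar>real k - real l\<bar>) + (\<Sum>l\<in>{k<..<L}. w \<bar>real k - real l\<bar>)"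
    by (simp add: sum.union_disjoint disjoint_iff)
  also have "(\<Sum>l\<in>{..k}. w \<bar>real k - real l\<bar>) = (\<Sum>j\<in>{..k}. w (real j))"
    by (rule sum.reindex_bij_witness[of _ "\<lambda>j. k - j" "\<lambda>l. k - l"]) (auto simp: of_nat_diff)
  also have "\<dots> \<le> (\<Sum>j<L. w (real j))"
    using assms by (intro sum_mono2) auto
  also have "(\<Sum>l\<in>{k<..<L}. w \<bar>real k - real l\<bar>) = (\<Sum>j\<in>{1..<L - k}. w (real j))"
    by (rule sum.reindex_bij_witness[of _ "\<lambda>j. k + j" "\<lambda>l. l - k"]) (auto simp: of_nat_diff)
  also have "\<dots> \<le> (\<Sum>j<L. w (real j))"
    using assms by (intro sum_mono2) auto
  finally show ?thesis by simp
qed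

section \<open>Product kernels and their off-diagonal terms\<close>

definition nat_vec :: "('n::finite \<Rightarrow> nat) \<Rightarrow> real ^ 'n" where
  "nat_vec k = (\<chi> i. real (k i))"

text \<open>With one polynomial per coordinate, both the sum of the squared coefficients and the sum
  of the decay bounds over the frequency box factorise.\<close>

definition prod_kernel :: "('n::finite \<Rightarrow> nat \<Rightarrow> real) \<Rightarrow> nat \<Rightarrow> real \<Rightarrow> real ^ 'n \<Rightarrow> complex" where
  "prod_kernel \<sigma> L q x = (\<Prod>i\<in>UNIV. \<Sum>j<L. of_real (\<sigma> i j) * cis (2 * pi * (q * real j * x $ i)))"

lemma continuous_on_prod_kernel: "continuous_on A (prod_kernel \<sigma> L q)"
  unfolding prod_kernel_def by (intro continuous_intros)

lemma norm_prod_kernel_le: "norm (prod_kernel \<sigma> L q x) \<le> (\<Prod>i\<in>UNIV. \<Sum>j<L. \<bar>\<sigma> i j\<bar>)"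
  unfolding prod_kernel_def
  by (simp add: prod_norm[symmetric])
     (intro prod_mono conjI norm_ge_zero order_trans[OF norm_sum] sum_mono, simp add: norm_mult)

lemma prod_kernel_expand:
  "prod_kernel \<sigma> L q x =
     (\<Sum>k\<in>UNIV \<rightarrow>\<^sub>E {..<L}. of_real (\<Prod>i\<in>UNIV. \<sigma> i (k i)) * char_fun (q *\<^sub>R nat_vec k) x)"
proof -
  have cis_sum: "(\<Prod>i\<in>A. cis (f i)) = cis (\<Sum>i\<in>A. f i)" if "finite A" for f :: "'a \<Rightarrow> real" and A
    using that by induction (auto simp: cis_mult)
  show ?thesis
    unfolding prod_kernel_def
    by (subst prod_sum_PiE)
       (auto simp: prod.distrib cis_sum char_fun_def nat_vec_def inner_vec_def sum_distrib_left mult_ac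
             intro!: sum.cong)
qed

text \<open>Distinct integer vectors are at distance at least 1 even when their coordinates at
  \<open>i\<close> agree, hence the maximum.\<close>

lemma norm_nat_vec_diff_ge:
  fixes k l :: "'n::finite \<Rightarrow> nat"
  assumes "k \<noteq> l"
  shows "max 1 \<bar>real (k i) - real (l i)\<bar> \<le> norm (nat_vec k - nat_vec l)"
proof -
  have comp: "\<bar>real (k j) - real (l j)\<bar> \<le> norm (nat_vec k - nat_vec l)" for j
    using component_le_norm_cart[of "nat_vec k - nat_vec l" j] by (simp add: nat_vec_def)
  obtain j where "k j \<noteq> l j" using assms by auto
  then have "1 \<le> \<bar>real (k j) - real (l j)\<bar>" by linarith
  with comp[of i] comp[of j] show ?thesis by auto
qed

text \<open>After expanding the square, the diagonal is exactly the subtracted main term. The other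
  frequencies are \<eta> plus \<open>q\<close> times a nonzero integer vector; the decay bounds
  their integrals, and a Schur test turns the row sums of \<rho> into the factor multiplying
  \<open>W\<close>. The upper bound on \<open>a\<close> gives \<open>b \<le> 1 / 2\<close>, as the
  power sum requires.\<close>

lemma prod_kernel_integral_bound:
  fixes \<mu> :: "(real ^ 'n) measure" and \<sigma> :: "'n \<Rightarrow> nat \<Rightarrow> real" and L :: nat
  assumes \<mu>: "prob_space \<mu>" "sets \<mu> = sets borel"
    and decay: "\<And>\<xi>. \<xi> \<noteq> 0 \<Longrightarrow> norm (fourier_transform \<mu> \<xi>) \<le> C * norm \<xi> powr (- a)"
    and a: "0 \<le> a" "a \<le> real CARD('n) / 2" and C: "0 \<le> C"
    and q: "0 < q" "2 * norm \<eta> \<le> q"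
  defines "W \<equiv> (\<Prod>i\<in>UNIV. \<Sum>j<L. (\<sigma> i j)\<^sup>2)"
  shows "norm ((\<integral>x. char_fun \<eta> x * of_real ((norm (prod_kernel \<sigma> L q x))\<^sup>2) \<partial>\<mu>) - W * (\<integral>x. char_fun \<eta> x \<partial>\<mu>))
     \<le> W * (C * (q / 2) powr (- a) * (6 * real L powr (1 - a / real CARD('n))) ^ CARD('n))"
proof -
  interpret prob_space \<mu> by fact
  define n where "n = real CARD('n)"
  have n: "n > 0" by (simp add: n_def)
  define b where "b = a / n"
  have b: "0 \<le> b" "b \<le> 1 / 2" using a n by (auto simp: b_def n_def field_simps)
  define I where "I = (UNIV \<rightarrow>\<^sub>E {..<L} :: ('n \<Rightarrow> nat) set)"
  have fin: "finite I" by (simp add: I_def finite_PiE)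
  define s where "s k = (\<Prod>i\<in>UNIV. \<sigma> i (k i))" for k
  define J where "J k l = (\<integral>x. char_fun (\<eta> + q *\<^sub>R (nat_vec k - nat_vec l)) x \<partial>\<mu>)" for k l :: "'n \<Rightarrow> nat"
  define \<rho> where "\<rho> k l = C * (q / 2) powr (- a) * (\<Prod>i\<in>UNIV. max 1 \<bar>real (k i) - real (l i)\<bar> powr (- b))"
    for k l :: "'n \<Rightarrow> nat"
  define \<rho>max where "\<rho>max = C * (q / 2) powr (- a) * (6 * real L powr (1 - b)) ^ CARD('n)"
  have int: "integrable \<mu> (char_fun \<zeta>)" for \<zeta>
    by (rule integrable_bounded_continuous[OF \<mu>, where B=1]) (auto intro: continuous_on_char_fun)
  have W: "W = (\<Sum>k\<in>I. (s k)\<^sup>2)"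
    unfolding W_def I_def s_def by (subst prod_sum_PiE) (auto simp: prod_power_distrib)
  have sq: "char_fun \<eta> x * of_real ((norm (prod_kernel \<sigma> L q x))\<^sup>2) =
      (\<Sum>k\<in>I. \<Sum>l\<in>I. of_real (s k * s l) * char_fun (\<eta> + q *\<^sub>R (nat_vec k - nat_vec l)) x)" for x
  proof -
    have "of_real ((norm (prod_kernel \<sigma> L q x))\<^sup>2) =
        (\<Sum>k\<in>I. of_real (s k) * char_fun (q *\<^sub>R nat_vec k) x) * (\<Sum>l\<in>I. of_real (s l) * char_fun (- (q *\<^sub>R nat_vec l)) x)"
      unfolding complex_norm_square prod_kernel_expand
      by (simp add: I_def s_def cnj_char_fun)
    also have "\<dots> = (\<Sum>k\<in>I. \<Sum>l\<in>I. of_real (s k * s l) * char_fun (q *\<^sub>R (nat_vec k - nat_vec l)) x)"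
      unfolding sum_product
      by (intro sum.cong refl) (simp add: scaleR_diff_right flip: char_fun_add)
    finally show ?thesis
      by (simp add: sum_distrib_left char_fun_add mult_ac)
  qed
  have "(\<integral>x. char_fun \<eta> x * of_real ((norm (prod_kernel \<sigma> L q x))\<^sup>2) \<partial>\<mu>) = (\<Sum>k\<in>I. \<Sum>l\<in>I. of_real (s k * s l) * J k l)"
    unfolding sq J_def by (simp add: int)
  moreover have "W * (\<integral>x. char_fun \<eta> x \<partial>\<mu>) = (\<Sum>k\<in>I. \<Sum>l\<in>I. if k = l then of_real (s k * s l) * J k l else 0)"
    using fin by (simp add: W J_def sum_distrib_right power2_eq_square)
  ultimately have "(\<integral>x. char_fun \<eta> x * of_real ((norm (prod_kernel \<sigma> L q x))\<^sup>2) \<partial>\<mu>) - W * (\<integral>x. char_fun \<eta> x \<partial>\<mu>)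
      = (\<Sum>k\<in>I. \<Sum>l\<in>I. of_real (s k * s l) * J k l - (if k = l then of_real (s k * s l) * J k l else 0))"
    by (simp add: sum_subtractf)
  \<comment> \<open>Schur test: the product of two coefficients is at most the mean of their
    squares, and as \<rho> is symmetric only its row sums remain.\<close>
  also have "norm \<dots> \<le> (\<Sum>k\<in>I. \<Sum>l\<in>I. ((s k)\<^sup>2 + (s l)\<^sup>2) / 2 * \<rho> k l)"
  proof (intro sum_norm_le)
    fix k l assume "k \<in> I" "l \<in> I"
    have \<rho>0: "\<rho> k l \<ge> 0" unfolding \<rho>_def using C by (intro mult_nonneg_nonneg prod_nonneg) auto
    show "norm (of_real (s k * s l) * J k l - (if k = l then of_real (s k * s l) * J k l else 0))
        \<le> ((s k)\<^sup>2 + (s l)\<^sup>2) / 2 * \<rho> k l"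
    proof (cases "k = l")
      case True then show ?thesis using \<rho>0 by simp
    next
      case False
      define v where "v = nat_vec k - nat_vec l"
      have v1: "max 1 \<bar>real (k i) - real (l i)\<bar> \<le> norm v" for i
        unfolding v_def by (rule norm_nat_vec_diff_ge) fact
      have "norm v \<ge> 1" using v1 by auto
      \<comment> \<open>The shift by \<eta>, of norm at most \<open>q / 2\<close>, takes away at
        most half of \<open>q * norm v\<close>.\<close>
      have "q * norm v \<le> norm (\<eta> + q *\<^sub>R v) + norm \<eta>"
        using norm_triangle_ineq4[of "\<eta> + q *\<^sub>R v" \<eta>] q by simp
      moreover have "norm \<eta> \<le> q / 2 * norm v"
        using mult_left_mono[OF \<open>norm v \<ge> 1\<close>, of "q / 2"] q by linarith
      ultimately have ge: "norm (\<eta> + q *\<^sub>R v) \<ge> q / 2 * norm v" by simp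
      have pos: "q / 2 * norm v > 0" using q \<open>norm v \<ge> 1\<close> by (intro mult_pos_pos) linarith+
      define \<zeta> where "\<zeta> = \<eta> + q *\<^sub>R v"
      have "\<zeta> \<noteq> 0" using ge pos by (auto simp: \<zeta>_def)
      have "norm (J k l) = norm (fourier_transform \<mu> (- \<zeta>))"
        by (simp only: J_def v_def \<zeta>_def fourier_transform_char_fun minus_minus)
      also have "\<dots> \<le> C * norm \<zeta> powr (- a)"
        using decay[of "- \<zeta>"] \<open>\<zeta> \<noteq> 0\<close> by simp
      also have "\<dots> \<le> C * (q / 2 * norm v) powr (- a)"
        using ge pos C a unfolding \<zeta>_def by (intro mult_left_mono powr_mono2') auto
      also have "(q / 2 * norm v) powr (- a) = (q / 2) powr (- a) * norm v powr (- a)"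
        by (rule powr_mult)
      also have "C * ((q / 2) powr (- a) * norm v powr (- a)) \<le> \<rho> k l"
      proof -
        \<comment> \<open>Splitting the decay evenly over the coordinates makes the sum over the box factorise.\<close>
        have "norm v powr (- a) = (norm v powr (- b)) ^ CARD('n)"
          using n powr_power[of "norm v" "- b" "CARD('n)"] \<open>norm v \<ge> 1\<close> by (force simp: b_def n_def)
        also have "\<dots> = (\<Prod>i\<in>(UNIV :: 'n set). norm v powr (- b))" by simp
        also have "\<dots> \<le> (\<Prod>i\<in>UNIV. max 1 \<bar>real (k i) - real (l i)\<bar> powr (- b))"
          using b v1 by (intro prod_mono conjI powr_mono2') auto
        finally show ?thesis
          using C unfolding \<rho>_def mult.assoc by (intro mult_left_mono) auto
      qed
      finally have "norm (J k l) \<le> \<rho> k l" .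
      moreover have "\<bar>s k * s l\<bar> \<le> ((s k)\<^sup>2 + (s l)\<^sup>2) / 2"
        using sum_squares_bound[of "\<bar>s k\<bar>" "\<bar>s l\<bar>"] by (simp add: abs_mult)
      ultimately have "\<bar>s k * s l\<bar> * norm (J k l) \<le> ((s k)\<^sup>2 + (s l)\<^sup>2) / 2 * \<rho> k l"
        by (intro mult_mono) auto
      then show ?thesis
        using False by (simp add: norm_mult abs_mult)
    qed
  qed
  also have "\<dots> = (\<Sum>k\<in>I. \<Sum>l\<in>I. (s k)\<^sup>2 * \<rho> k l)"
  proof -
    have "\<rho> k l = \<rho> l k" for k l by (simp add: \<rho>_def abs_minus_commute)
    then have "(\<Sum>k\<in>I. \<Sum>l\<in>I. (s l)\<^sup>2 * \<rho> k l) = (\<Sum>k\<in>I. \<Sum>l\<in>I. (s k)\<^sup>2 * \<rho> k l)"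
      by (subst sum.swap) simp
    moreover have "(\<Sum>k\<in>I. \<Sum>l\<in>I. ((s k)\<^sup>2 + (s l)\<^sup>2) / 2 * \<rho> k l) =
        ((\<Sum>k\<in>I. \<Sum>l\<in>I. (s k)\<^sup>2 * \<rho> k l) + (\<Sum>k\<in>I. \<Sum>l\<in>I. (s l)\<^sup>2 * \<rho> k l)) / 2"
      by (simp add: sum_divide_distrib add_divide_distrib distrib_right flip: sum.distrib)
    ultimately show ?thesis by simp
  qed
  also have "\<dots> \<le> (\<Sum>k\<in>I. (s k)\<^sup>2 * \<rho>max)"
    unfolding sum_distrib_left[symmetric]
  proof (intro sum_mono mult_left_mono)
    fix k assume k: "k \<in> I"
    have "(\<Sum>l\<in>I. \<rho> k l) = C * (q / 2) powr (- a) * (\<Prod>i\<in>UNIV. \<Sum>l<L. max 1 \<bar>real (k i) - real l\<bar> powr (- b))"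
      unfolding \<rho>_def sum_distrib_left[symmetric] I_def by (subst prod_sum_PiE) auto
    \<comment> \<open>The 6 is the 2 from counting both sides of \<open>k i\<close> times the 3 of
      \<open>sum_powr_minus_le\<close>.\<close>
    also have "\<dots> \<le> C * (q / 2) powr (- a) * (\<Prod>i\<in>(UNIV :: 'n set). 6 * real L powr (1 - b))"
    proof (intro mult_left_mono prod_mono conjI sum_nonneg)
      fix i
      have "k i < L" using k by (auto simp: I_def)
      then have "(\<Sum>l<L. max 1 \<bar>real (k i) - real l\<bar> powr (- b)) \<le> 2 * (\<Sum>j<L. max 1 (real j) powr (- b))"
        by (intro sum_nat_dist_le[where w="\<lambda>t. max 1 t powr (- b)"]) auto
      with sum_powr_minus_le[OF b, of L]
      show "(\<Sum>l<L. max 1 \<bar>real (k i) - real l\<bar> powr (- b)) \<le> 6 * real L powr (1 - b)" by simp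
    qed (use C in auto)
    finally show "(\<Sum>l\<in>I. \<rho> k l) \<le> \<rho>max" by (simp add: \<rho>max_def)
  qed auto
  also have "\<dots> = W * \<rho>max" by (simp add: W sum_distrib_right)
  finally show ?thesis by (simp add: \<rho>max_def b_def n_def)
qed

text \<open>The factor \<open>c m\<close> times the sum of squared coefficients is
  \<open>\<theta> m\<close>, at most 1, so the error bound is uniform over all coefficients and
  these may vary with \<open>m\<close>. The limit \<open>\<theta> m\<close> is the mean of
  \<open>h m\<close> over the torus when \<open>m \<ge> 1\<close>.\<close>

lemma prod_kernel_equidistribution:
  fixes \<mu> :: "(real ^ 'n) measure" and \<sigma> :: "nat \<Rightarrow> 'n \<Rightarrow> nat \<Rightarrow> real"
  assumes \<mu>: "prob_space \<mu>" "sets \<mu> = sets borel"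
    and K: "compact K" "AE x in \<mu>. x \<in> K"
    and decay: "\<And>\<xi>. \<xi> \<noteq> 0 \<Longrightarrow> norm (fourier_transform \<mu> \<xi>) \<le> C * norm \<xi> powr (- a)"
    and a: "real CARD('n) / (real CARD('n) + 1) < a" "a \<le> real CARD('n) / 2" and C: "0 \<le> C"
    and c: "\<And>m. 0 \<le> c m"
    and \<theta>: "\<And>m. \<theta> m = c m * (\<Prod>i\<in>UNIV. \<Sum>j<B * m. (\<sigma> m i j)\<^sup>2)" "\<And>m. \<theta> m \<le> 1"
    and h: "\<And>m x. h m x = c m * (norm (prod_kernel (\<sigma> m) (B * m) (real (m ^ CARD('n))) x))\<^sup>2"
    and f: "continuous_on UNIV f" "\<And>x. \<bar>f x\<bar> \<le> D"
  shows "(\<lambda>m. (\<integral>x. f x * h m x \<partial>\<mu>) - \<theta> m * (\<integral>x. f x \<partial>\<mu>)) \<longlonglongrightarrow> 0"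
proof (rule tendsto_integral_continuous_if_characters[OF \<mu> K _ _ _ _ \<theta>(2) _ f])
  define n where "n = real CARD('n)"
  have n: "n \<ge> 1" by (simp add: n_def Suc_leI)
  have a0: "0 \<le> a" using a(1) n by (smt (verit) n_def divide_nonneg_nonneg)
  show "continuous_on UNIV (h m)" for m
    unfolding h by (intro continuous_intros continuous_on_prod_kernel)
  show "0 \<le> h m x" for m x using c by (simp add: h)
  show "h m x \<le> c m * (\<Prod>i\<in>UNIV. \<Sum>j<B * m. \<bar>\<sigma> m i j\<bar>)\<^sup>2" for m x
    unfolding h by (intro mult_left_mono power_mono norm_prod_kernel_le c norm_ge_zero)
  show \<theta>0: "0 \<le> \<theta> m" for m
    unfolding \<theta> using c by (intro mult_nonneg_nonneg prod_nonneg sum_nonneg) auto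
  fix \<eta> :: "real ^ 'n"
  define E where "E m = C * (2 powr a * 6 ^ CARD('n) * real B powr (n - a)) * real m powr (n - a - n * a)" for m
  \<comment> \<open>The threshold \<open>n / (n + 1)\<close> enters here: the dilation by
    \<open>m ^ n\<close> gives the exponent \<open>- n * a\<close>, and the box of side
    \<open>B * m\<close> gives \<open>n - a\<close>.\<close>
  have "n - a - n * a < 0"
    using a(1) n by (simp add: n_def field_simps)
  then have "(\<lambda>m. real m powr (n - a - n * a)) \<longlonglongrightarrow> 0"
    by (intro tendsto_neg_powr filterlim_real_sequentially)
  then have E: "E \<longlonglongrightarrow> 0"
    unfolding E_def by (rule tendsto_mult_right_zero)
  obtain N :: nat where N: "2 * norm \<eta> \<le> real N" using real_arch_simple by blast
  show "(\<lambda>m. (\<integral>x. char_fun \<eta> x * h m x \<partial>\<mu>) - \<theta> m * (\<integral>x. char_fun \<eta> x \<partial>\<mu>)) \<longlonglongrightarrow> 0"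
  proof (rule Lim_null_comparison[OF eventually_sequentiallyI[of "max 1 N"] E])
    fix m assume m: "max 1 N \<le> m"
    then have m1: "m \<ge> 1" by simp
    define q where "q = real (m ^ CARD('n))"
    \<comment> \<open>So the dilation eventually exceeds \<open>2 * norm \<eta>\<close>.\<close>
    have "m \<le> m ^ CARD('n)" using m1 by (intro self_le_power) auto
    then have q: "0 < q" "2 * norm \<eta> \<le> q"
      using m N by (auto simp: q_def simp del: of_nat_power)
    define W where "W = (\<Prod>i\<in>UNIV. \<Sum>j<B * m. (\<sigma> m i j)\<^sup>2)"
    have "(\<integral>x. char_fun \<eta> x * h m x \<partial>\<mu>) - \<theta> m * (\<integral>x. char_fun \<eta> x \<partial>\<mu>) =
        c m * ((\<integral>x. char_fun \<eta> x * of_real ((norm (prod_kernel (\<sigma> m) (B * m) q x))\<^sup>2) \<partial>\<mu>) - W * (\<integral>x. char_fun \<eta> x \<partial>\<mu>))"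
      unfolding h \<theta>(1) q_def[symmetric] W_def[symmetric]
      by (simp add: right_diff_distrib mult.left_commute[of _ "complex_of_real (c m)"] mult.assoc)
    also have "norm \<dots> \<le> c m * (W * (C * (q / 2) powr (- a) * (6 * real (B * m) powr (1 - a / real CARD('n))) ^ CARD('n)))"
      unfolding norm_mult W_def norm_of_real abs_of_nonneg[OF c]
      by (intro mult_left_mono prod_kernel_integral_bound[OF \<mu> decay a0 a(2) C q] c)
    also have "\<dots> = \<theta> m * (C * (q / 2) powr (- a) * (6 * real (B * m) powr (1 - a / real CARD('n))) ^ CARD('n))"
      by (simp add: \<theta>(1) W_def)
    also have "\<dots> \<le> 1 * (C * (q / 2) powr (- a) * (6 * real (B * m) powr (1 - a / real CARD('n))) ^ CARD('n))"
      using C by (intro mult_right_mono \<theta>(2)) auto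
    also have "(q / 2) powr (- a) = 2 powr a * real m powr (- (n * a))"
    proof -
      have "q = real m powr n" using m1 by (simp add: q_def n_def powr_realpow)
      then show ?thesis using m1 by (simp add: powr_divide powr_powr powr_minus field_simps)
    qed
    also have "(6 * real (B * m) powr (1 - a / real CARD('n))) ^ CARD('n) = 6 ^ CARD('n) * (real B powr (n - a) * real m powr (n - a))"
    proof -
      have "(t powr (1 - a / real CARD('n))) ^ CARD('n) = t powr (n - a)" for t
        using n by (cases "t = 0") (simp_all add: powr_power n_def right_diff_distrib)
      then show ?thesis by (simp add: power_mult_distrib powr_mult)
    qed
    also have "1 * (C * (2 powr a * real m powr (- (n * a))) * (6 ^ CARD('n) * (real B powr (n - a) * real m powr (n - a)))) = E m"
      unfolding E_def by (simp add: powr_diff powr_minus divide_inverse mult_ac)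
    finally show "norm ((\<integral>x. char_fun \<eta> x * h m x \<partial>\<mu>) - \<theta> m * (\<integral>x. char_fun \<eta> x \<partial>\<mu>)) \<le> E m" .
  qed
qed

subsection \<open>Tent coefficients and the distance to the lattice\<close>

text \<open>By concavity the sine lies above its chord between 0 and \<open>pi / 2\<close>.\<close>

lemma jordan_sin_ge:
  assumes "0 \<le> x" "x \<le> pi / 2" shows "2 * x / pi \<le> sin x"
proof -
  have "concave_on {0..pi} sin"
    by (rule f''_le0_imp_concave[where f'=cos and f''="\<lambda>x. - sin x"])
       (auto intro!: derivative_eq_intros sin_ge_zero)
  from concave_onD[OF this, of "2 * x / pi" 0 "pi / 2"] assms
  show ?thesis by (auto simp: field_simps)
qed

text \<open>Only the offset \<open>r\<close> of \<open>t\<close> from its nearest integer matters.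
  The left-hand bound comes from Jordan's inequality for
  \<open>2 * \<bar>sin (pi * r)\<bar>\<close>, available because \<open>r\<close> is at most 1/2 in
  absolute value.\<close>

lemma norm_one_minus_cis_ge: "4 * \<bar>t - of_int (round t)\<bar> \<le> norm (1 - cis (2 * pi * t))"
proof -
  define r where "r = t - of_int (round t)"
  have r: "\<bar>r\<bar> \<le> 1 / 2"
    using of_int_round_abs_le[of t] by (simp add: r_def abs_minus_commute)
  have "cis (2 * pi * t) = cis (2 * pi * r) * cis (2 * pi * of_int (round t))"
    by (simp add: cis_mult r_def algebra_simps del: cis_multiple_2pi)
  then have "cis (2 * pi * t) = cis (2 * pi * r)" by simp
  then have "norm (1 - cis (2 * pi * t)) = 2 * \<bar>sin (pi * r)\<bar>"
    using dist_exp_i_1[of "2 * pi * r"] by (simp add: cis_conv_exp norm_minus_commute)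
  moreover have "\<bar>sin (pi * r)\<bar> = \<bar>sin (pi * \<bar>r\<bar>)\<bar>"
    by (simp add: abs_if)
  moreover have "2 * \<bar>r\<bar> \<le> \<bar>sin (pi * \<bar>r\<bar>)\<bar>"
    using jordan_sin_ge[of "pi * \<bar>r\<bar>"] r by (auto simp: mult_left_le)
  ultimately show ?thesis by (simp add: r_def)
qed

text \<open>Rounding every coordinate yields one lattice point, whose distance to \<open>y\<close>
  bounds the infimum.\<close>

lemma nearest_int_dist_sq_le:
  fixes y :: "real ^ 'n"
  shows "16 * (nearest_int_dist y)\<^sup>2 \<le> (\<Sum>i\<in>UNIV. (norm (1 - cis (2 * pi * y $ i)))\<^sup>2)"
proof -
  define z :: "real ^ 'n" where "z = (\<chi> i. of_int (round (y $ i)))"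
  have "z \<in> int_lattice" by (simp add: z_def int_lattice_def)
  then have "nearest_int_dist y \<le> dist y z"
    unfolding nearest_int_dist_def by (rule infdist_le)
  then have "(nearest_int_dist y)\<^sup>2 \<le> (dist y z)\<^sup>2"
    by (intro power_mono) (auto simp: nearest_int_dist_def infdist_nonneg)
  also have "\<dots> = (\<Sum>i\<in>UNIV. (y $ i - of_int (round (y $ i)))\<^sup>2)"
    by (simp add: dist_norm norm_vec_def L2_set_def z_def sum_nonneg)
  finally have "16 * (nearest_int_dist y)\<^sup>2 \<le> (\<Sum>i\<in>UNIV. (4 * \<bar>y $ i - of_int (round (y $ i))\<bar>)\<^sup>2)"
    by (simp add: power_mult_distrib flip: sum_distrib_left)
  also have "\<dots> \<le> (\<Sum>i\<in>UNIV. (norm (1 - cis (2 * pi * y $ i)))\<^sup>2)"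
    by (intro sum_mono power_mono norm_one_minus_cis_ge) auto
  finally show ?thesis .
qed

text \<open>Summation by parts. The zeros at both ends remove the boundary terms, so the differences
  still occupy \<open>L\<close> coefficients; the shift of index costs only a factor of modulus
  1.\<close>

lemma norm_trig_sum_differences:
  fixes s :: "nat \<Rightarrow> real"
  assumes "s 0 = 0" "s L = 0"
  shows "norm (\<Sum>j<L. of_real (s (Suc j) - s j) * cis (2 * pi * (real j * u))) =
         norm (1 - cis (2 * pi * u)) * norm (\<Sum>j<L. of_real (s j) * cis (2 * pi * (real j * u)))"
proof -
  define w where "w = cis (2 * pi * u)"
  have w: "cis (2 * pi * (real j * u)) = w ^ j" for j
    by (simp add: w_def Complex.DeMoivre mult_ac)
  have "w * (\<Sum>j<N. of_real (s (Suc j) - s j) * w ^ j) =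
      (1 - w) * (\<Sum>j<N. of_real (s j) * w ^ j) - of_real (s 0) + of_real (s N) * w ^ N" for N
    by (induction N) (simp_all add: algebra_simps)
  from this[of L] have "w * (\<Sum>j<L. of_real (s (Suc j) - s j) * w ^ j) = (1 - w) * (\<Sum>j<L. of_real (s j) * w ^ j)"
    using assms by simp
  from arg_cong[OF this, of norm] show ?thesis
    unfolding w by (simp add: norm_mult w_def)
qed

text \<open>The tent vanishes at 0 and \<open>2 * M\<close>, as summation by parts needs. Its
  squares sum to order \<open>M ^ 3\<close> but those of its unit differences only to
  \<open>2 * M\<close>; this ratio is the gain of order \<open>1 / M\<^sup>2\<close>.\<close>

definition tent :: "nat \<Rightarrow> nat \<Rightarrow> real" where
  "tent M j = real (min j (2 * M - j))"

text \<open>Differencing in the coordinate \<open>i\<close> alone: up to a phase, this multiplies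
  the tent kernel by \<open>1 - cis (2 * pi * q * x $ i)\<close>.\<close>

definition tent_step :: "nat \<Rightarrow> 'n \<Rightarrow> 'n \<Rightarrow> nat \<Rightarrow> real" where
  "tent_step M i l j = (if l = i then tent M (Suc j) - tent M j else tent M j)"

lemma tent_left: "j \<le> M \<Longrightarrow> tent M j = real j"
  and tent_right: "M \<le> j \<Longrightarrow> tent M j = real (2 * M - j)"
  by (auto simp: tent_def min_def)

lemma norm_prod_kernel_tent_step:
  "norm (prod_kernel (tent_step M i) (2 * M) q x) =
     norm (1 - cis (2 * pi * (q * x $ i))) * norm (prod_kernel (\<lambda>_. tent M) (2 * M) q x)"
proof -
  define F where "F s u = norm (\<Sum>j<2 * M. of_real (s j) * cis (2 * pi * (real j * u)))" for s u
  have *: "norm (prod_kernel \<sigma> (2 * M) q x) = F (\<sigma> i) (q * x $ i) * (\<Prod>l\<in>UNIV - {i}. F (\<sigma> l) (q * x $ l))" for \<sigma>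
    unfolding prod_kernel_def F_def by (simp add: prod.remove[of UNIV i] prod_norm[symmetric] norm_mult mult_ac)
  have "F (tent_step M i i) u = norm (1 - cis (2 * pi * u)) * F (tent M) u" for u
    unfolding F_def tent_step_def using norm_trig_sum_differences[of "tent M" "2 * M" u] by (simp add: tent_def)
  moreover have "(\<Prod>l\<in>UNIV - {i}. F (tent_step M i l) (q * x $ l)) = (\<Prod>l\<in>UNIV - {i}. F (tent M) (q * x $ l))"
    by (intro prod.cong) (auto simp: tent_step_def[abs_def])
  ultimately show ?thesis by (simp add: *)
qed

text \<open>The rising half of the tent suffices.\<close>

lemma sum_tent_sq_ge: "real M ^ 3 / 3 \<le> (\<Sum>j<2 * M. (tent M j)\<^sup>2)"
proof (cases "M = 0")
  case False
  have "real N ^ 3 / 3 \<le> (\<Sum>j\<le>N. (real j)\<^sup>2)" for N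
    by (induction N) (simp_all add: power2_eq_square power3_eq_cube field_simps)
  from this[of M] have "real M ^ 3 / 3 \<le> (\<Sum>j\<le>M. (tent M j)\<^sup>2)"
    by (simp add: tent_left)
  also have "\<dots> \<le> (\<Sum>j<2 * M. (tent M j)\<^sup>2)"
    using False by (intro sum_mono2) auto
  finally show ?thesis .
qed simp

lemma sum_tent_step_sq: "(\<Sum>j<2 * M. (tent_step M i i j)\<^sup>2) = 2 * real M"
proof -
  have "(tent_step M i i j)\<^sup>2 = 1" if "j < 2 * M" for j
    using that by (cases "j < M") (auto simp: tent_step_def tent_left tent_right of_nat_diff)
  then show ?thesis by simp
qed

lemma prod_sum_tent_step_sq:
  fixes i :: "'n::finite"
  shows "(\<Prod>l\<in>UNIV. \<Sum>j<2 * M. (tent_step M i l j)\<^sup>2) =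
    2 * real M * (\<Sum>j<2 * M. (tent M j)\<^sup>2) ^ (CARD('n) - 1)"
proof -
  have "(\<Prod>l\<in>UNIV - {i}. \<Sum>j<2 * M. (tent_step M i l j)\<^sup>2) = (\<Prod>l\<in>UNIV - {i}. \<Sum>j<2 * M. (tent M j)\<^sup>2)"
    by (intro prod.cong sum.cong) (auto simp: tent_step_def)
  then show ?thesis
    by (simp add: prod.remove[of UNIV i] sum_tent_step_sq card_Diff_singleton)
qed

subsection \<open>Localisation in the badly approximable vectors\<close>

text \<open>Fixing the constant makes the set closed, so that Baire's theorem can select one
  constant on a piece of the support.\<close>

definition Bad_const :: "real \<Rightarrow> (real ^ 'n) set" where
  "Bad_const c = {x. \<forall>q::nat. q \<ge> 1 \<longrightarrow>
     c * real q powr (- 1 / real CARD('n)) \<le> nearest_int_dist (real q *\<^sub>R x)}"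

lemma closed_Bad_const: "closed (Bad_const c :: (real ^ 'n) set)"
proof -
  have "Bad_const c = (\<Inter>q\<in>{1..}. {x :: real ^ 'n.
      c * real q powr (- 1 / real CARD('n)) \<le> infdist (real q *\<^sub>R x) int_lattice})"
    by (auto simp: Bad_const_def nearest_int_dist_def)
  also have "closed \<dots>"
    by (intro closed_INT ballI closed_Collect_le continuous_intros)
  finally show ?thesis .
qed

lemma Bad_eq_Union_Bad_const: "Bad = (\<Union>j. Bad_const (1 / real (Suc j)) :: (real ^ 'n) set)"
proof -
  have "\<exists>j. x \<in> Bad_const (1 / real (Suc j))" if x: "x \<in> Bad" for x :: "real ^ 'n"
  proof -
    obtain c where c: "c > 0" "\<And>q::nat. q \<ge> 1 \<Longrightarrow> c * real q powr (- 1 / real CARD('n)) \<le> nearest_int_dist (real q *\<^sub>R x)"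
      using x by (auto simp: Bad_def)
    obtain j where j: "1 / real (Suc j) < c"
      using nat_approx_posE[OF c(1)] by (auto simp: divide_inverse)
    have "1 / real (Suc j) * real q powr (- 1 / real CARD('n)) \<le> nearest_int_dist (real q *\<^sub>R x)" if "q \<ge> 1" for q
      using c(2)[OF that] j by (intro order_trans[OF mult_right_mono c(2)[OF that]]) auto
    then show ?thesis by (auto simp: Bad_const_def)
  qed
  moreover have "Bad_const (1 / real (Suc j)) \<subseteq> (Bad :: (real ^ 'n) set)" for j
    unfolding Bad_const_def Bad_def by (auto intro!: exI[of _ "1 / real (Suc j)"])
  ultimately show ?thesis by auto
qed

text \<open>Otherwise every \<open>K - F j\<close> is relatively open and dense in \<open>K\<close>,
  so their intersection is dense; but the cover makes it empty.\<close>

lemma Baire_closed_cover: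
  fixes K :: "'a::{real_normed_vector, heine_borel} set"
  assumes "closed K" "K \<noteq> {}" "K \<subseteq> (\<Union>j::nat. F j)" "\<And>j. closed (F j)"
  obtains j x r where "x \<in> K" "r > 0" "K \<inter> ball x r \<subseteq> F j"
proof -
  have "\<exists>j x r. x \<in> K \<and> r > 0 \<and> K \<inter> ball x r \<subseteq> F j"
  proof (rule ccontr)
    assume *: "\<not> ?thesis"
    have "K \<subseteq> closure (\<Inter>(range (\<lambda>j. K - F j)))"
    proof (rule Baire[OF assms(1)])
      fix T assume "T \<in> range (\<lambda>j. K - F j)"
      then obtain j where T: "T = K - F j" by auto
      have "openin (top_of_set K) T"
        unfolding T Diff_eq using assms(4) by (intro openin_open_Int) auto
      moreover have "K \<subseteq> closure T"
      proof
        fix x assume "x \<in> K"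
        have "\<exists>y\<in>T. dist y x < e" if "e > 0" for e
          using * \<open>x \<in> K\<close> that by (fastforce simp: T dist_commute)
        then show "x \<in> closure T" by (simp add: closure_approachable)
      qed
      ultimately show "openin (top_of_set K) T \<and> K \<subseteq> closure T" by simp
    qed auto
    moreover have "\<Inter>(range (\<lambda>j. K - F j)) = {}" using assms(3) by auto
    ultimately show False using assms(2) by (simp only: closure_empty subset_empty)
  qed
  with that show ?thesis by blast
qed

text \<open>The dilation \<open>m ^ n\<close> is chosen so that its power \<open>- 1 / n\<close> is
  exactly \<open>1 / m\<close>.\<close>

lemma Bad_const_kernel_le:
  fixes x :: "real ^ 'n"
  assumes "x \<in> Bad_const c" "c > 0" "m \<ge> 1"
  shows "16 * c\<^sup>2 / (real m)\<^sup>2 * (norm (prod_kernel (\<lambda>_. tent M) (2 * M) (real (m ^ CARD('n))) x))\<^sup>2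
    \<le> (\<Sum>i\<in>UNIV. (norm (prod_kernel (tent_step M i) (2 * M) (real (m ^ CARD('n))) x))\<^sup>2)"
proof -
  define q where "q = m ^ CARD('n)"
  have "real q powr (- 1 / real CARD('n)) = 1 / real m"
  proof -
    have "real q = real m powr real CARD('n)" using assms(3) by (simp add: q_def powr_realpow)
    then show ?thesis using assms(3) by (simp add: powr_powr powr_minus_divide)
  qed
  moreover have "q \<ge> 1" using assms(3) by (simp add: q_def)
  ultimately have "c / real m \<le> nearest_int_dist (real q *\<^sub>R x)"
    using assms(1) by (auto simp: Bad_const_def)
  then have "(c / real m)\<^sup>2 \<le> (nearest_int_dist (real q *\<^sub>R x))\<^sup>2"
    using assms(2) by (intro power_mono) auto
  with nearest_int_dist_sq_le[of "real q *\<^sub>R x"]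
  have "16 * c\<^sup>2 / (real m)\<^sup>2 \<le> (\<Sum>i\<in>UNIV. (norm (1 - cis (2 * pi * (real q * x $ i))))\<^sup>2)"
    by (simp add: power_divide)
  then have "16 * c\<^sup>2 / (real m)\<^sup>2 * (norm (prod_kernel (\<lambda>_. tent M) (2 * M) (real q) x))\<^sup>2
    \<le> (\<Sum>i\<in>UNIV. (norm (1 - cis (2 * pi * (real q * x $ i))))\<^sup>2) * (norm (prod_kernel (\<lambda>_. tent M) (2 * M) (real q) x))\<^sup>2"
    by (intro mult_right_mono) auto
  then show ?thesis
    unfolding norm_prod_kernel_tent_step power_mult_distrib sum_distrib_right by (simp add: q_def)
qed

section \<open>Decay of measures supported in \<open>Bad\<close>\<close>

lemma integral_bump_pos:
  fixes \<mu> :: "'a::metric_space measure"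
  assumes \<mu>: "prob_space \<mu>" "sets \<mu> = sets borel" and x: "x0 \<in> measure_support \<mu>" and r: "r > 0"
  shows "0 < (\<integral>x. max 0 (r - dist x x0) \<partial>\<mu>)"
proof -
  interpret prob_space \<mu> by fact
  \<comment> \<open>The bump is at least \<open>r / 2\<close> on the half ball, which has positive
    mass because its centre is in the support.\<close>
  have b: "ball x0 (r / 2) \<in> sets \<mu>" by (simp add: \<mu>)
  have "emeasure \<mu> (ball x0 (r / 2)) > 0"
    using x r by (auto simp: measure_support_def)
  then have "0 < r / 2 * measure \<mu> (ball x0 (r / 2))"
    using r by (simp add: emeasure_eq_measure)
  also have "\<dots> = (\<integral>x. r / 2 * indicator (ball x0 (r / 2)) x \<partial>\<mu>)"
    using b by simp
  also have "\<dots> \<le> (\<integral>x. max 0 (r - dist x x0) \<partial>\<mu>)"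
  proof (rule integral_mono)
    show "integrable \<mu> (\<lambda>x. r / 2 * indicator (ball x0 (r / 2)) x)"
      using b by (intro integrable_mult_right integrable_real_indicator) (auto simp: emeasure_eq_measure)
    show "integrable \<mu> (\<lambda>x. max 0 (r - dist x x0))"
      using r by (intro integrable_bounded_continuous[OF \<mu>, where B=r] continuous_intros) auto
    show "r / 2 * indicator (ball x0 (r / 2)) x \<le> max 0 (r - dist x x0)" for x
      using r by (auto simp: indicator_def dist_commute)
  qed
  finally show ?thesis .
qed

text \<open>Treats one admissible exponent; the theorem then only takes suprema. With
  \<open>a = s / 2\<close> the negated conclusion is the lower bound on \<open>a\<close> required
  for equidistribution, and \<open>s \<le> n\<close> is the upper one.\<close>

lemma fourier_decay_exponent_le:
  fixes \<mu> :: "(real ^ 'n) measure"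
  assumes \<mu>: "\<mu> \<in> compact_prob_measures Bad"
    and s: "0 \<le> s" "s \<le> real CARD('n)"
    and decay: "\<And>\<xi>. \<xi> \<noteq> 0 \<Longrightarrow> norm (fourier_transform \<mu> \<xi>) \<le> C * norm \<xi> powr (- s / 2)"
  shows "s \<le> 2 * real CARD('n) / (real CARD('n) + 1)"
proof (rule ccontr)
  assume contr: "\<not> s \<le> 2 * real CARD('n) / (real CARD('n) + 1)"
  define n where "n = real CARD('n)"
  have n: "n \<ge> 1" by (simp add: n_def Suc_leI)
  define a where "a = s / 2"
  have a: "real CARD('n) / (real CARD('n) + 1) < a" "a \<le> real CARD('n) / 2"
    using contr s by (auto simp: a_def not_le mult.commute)
  have ps: "prob_space \<mu>" and sets: "sets \<mu> = sets borel"
    and K: "compact (measure_support \<mu>)" "measure_support \<mu> \<subseteq> Bad"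
    using \<mu> by (auto simp: compact_prob_measures_def)
  interpret prob_space \<mu> by fact
  define K where "K = measure_support \<mu>"
  have AE_K: "AE x in \<mu>. x \<in> K"
    unfolding K_def by (rule AE_in_measure_support) fact
  have "K \<noteq> {}"
    using AE_K by (auto simp: AE_False)
  then obtain j x0 r where x0: "x0 \<in> K" and r: "r > 0"
    and sub: "K \<inter> ball x0 r \<subseteq> Bad_const (1 / real (Suc j))"
    using Baire_closed_cover[of K "\<lambda>j. Bad_const (1 / real (Suc j))"] K closed_Bad_const
    by (metis K_def Bad_eq_Union_Bad_const compact_imp_closed)
  define c where "c = 1 / real (Suc j)"
  have c: "c > 0" by (simp add: c_def)
  define f where "f x = max 0 (r - dist x x0)" for x
  have f: "continuous_on UNIV f" "\<And>x. \<bar>f x\<bar> \<le> r"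
    unfolding f_def using r by (auto intro!: continuous_intros)
  have f0: "f x \<ge> 0" for x by (simp add: f_def)
  have f_pos: "0 < integral\<^sup>L \<mu> f"
    unfolding f_def using integral_bump_pos[OF ps sets _ r] x0 by (simp add: K_def)
  \<comment> \<open>The tents have half-width \<open>A * m\<close>. Taking \<open>A * c\<close> at
    least \<open>n\<close> makes each differenced weight have mean at most
    \<open>1 / (2 * n)\<close>.\<close>
  obtain A :: nat where "n / c < real A" using reals_Archimedean2 by blast
  then have A: "n \<le> real A * c" "A > 0"
    using c n by (auto simp: field_simps intro!: Nat.gr0I)
  define V where "V m = (\<Sum>j<2 * (A * m). (tent (A * m) j)\<^sup>2)" for m
  have V0: "V m \<ge> 0" for m unfolding V_def by (intro sum_nonneg) auto
  have V_ge: "real (A * m) ^ 3 / 3 \<le> V m" for m unfolding V_def by (rule sum_tent_sq_ge)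
  have V_pos: "V m > 0" if "m \<ge> 1" for m
    using that A(2) by (intro less_le_trans[OF _ V_ge]) auto
  define S where "S m x = (norm (prod_kernel (\<lambda>_. tent (A * m)) (2 * (A * m)) (real (m ^ CARD('n))) x))\<^sup>2"
    for m and x :: "real ^ 'n"
  define T where "T i m x = (norm (prod_kernel (tent_step (A * m) i) (2 * (A * m)) (real (m ^ CARD('n))) x))\<^sup>2"
    for i m and x :: "real ^ 'n"
  \<comment> \<open>Chosen so that \<kappa> times \<open>16 * c\<^sup>2 / m\<^sup>2\<close> is the
    normalisation \<open>1 / V m ^ n\<close> of the tent kernel.\<close>
  define \<kappa> where "\<kappa> m = (real m)\<^sup>2 / (16 * c\<^sup>2 * V m ^ CARD('n))" for m
  define \<theta> where "\<theta> m = \<kappa> m * (2 * real (A * m) * V m ^ (CARD('n) - 1))" for m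
  \<comment> \<open>Equal to 1 for \<open>m \<ge> 1\<close>. At \<open>m = 0\<close> the sum
    \<open>V\<close> is 0 and division by zero gives 0, so the unreduced form meets the
    equidistribution hypothesis for every \<open>m\<close>.\<close>
  define \<phi> where "\<phi> m = 1 / V m ^ CARD('n) * V m ^ CARD('n)" for m
  have \<theta>_le: "\<theta> m \<le> 1 / (2 * n)" for m
  proof (cases "m \<ge> 1")
    case True
    have "V m ^ CARD('n) = V m * V m ^ (CARD('n) - 1)"
      by (simp flip: power_Suc)
    then have "\<theta> m = (real m)\<^sup>2 * (2 * real (A * m)) / (16 * c\<^sup>2 * V m)"
      using V_pos[OF True] by (simp add: \<theta>_def \<kappa>_def)
    also have "\<dots> \<le> (real m)\<^sup>2 * (2 * real (A * m)) / (16 * c\<^sup>2 * (real (A * m) ^ 3 / 3))"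
      using c True A V_ge[of m] V_pos[OF True] by (intro divide_left_mono mult_left_mono mult_pos_pos) auto
    also have "\<dots> = 3 / (8 * (real A * c)\<^sup>2)"
      using c True A by (simp add: field_simps power2_eq_square power3_eq_cube)
    also have "\<dots> \<le> 3 / (8 * n\<^sup>2)"
      using A c n by (intro divide_left_mono mult_left_mono power_mono mult_pos_pos) auto
    also have "\<dots> \<le> 1 / (2 * n)"
      using n by (simp add: field_simps power2_eq_square)
    finally show ?thesis .
  next
    case False
    then have "m = 0" by simp
    then show ?thesis using n by (simp add: \<theta>_def)
  qed
  have decay': "norm (fourier_transform \<mu> \<xi>) \<le> \<bar>C\<bar> * norm \<xi> powr (- a)" if "\<xi> \<noteq> 0" for \<xi>
  proof -
    have "C * norm \<xi> powr (- s / 2) \<le> \<bar>C\<bar> * norm \<xi> powr (- s / 2)"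
      by (intro mult_right_mono) auto
    with decay[OF that] show ?thesis by (simp add: a_def)
  qed
  note equidist = prod_kernel_equidistribution[OF ps sets _ AE_K decay' a abs_ge_zero _ _ _ _ f, where B="2 * A"]
  have lim_S: "(\<lambda>m. (\<integral>x. f x * (1 / V m ^ CARD('n) * S m x) \<partial>\<mu>) - \<phi> m * integral\<^sup>L \<mu> f) \<longlonglongrightarrow> 0"
    by (rule equidist[where \<sigma>="\<lambda>m _. tent (A * m)" and c="\<lambda>m. 1 / V m ^ CARD('n)"])
       (use K V0 in \<open>auto simp: K_def S_def \<phi>_def V_def mult.assoc\<close>)
  have lim_T: "(\<lambda>m. (\<integral>x. f x * (\<kappa> m * T i m x) \<partial>\<mu>) - \<theta> m * integral\<^sup>L \<mu> f) \<longlonglongrightarrow> 0" for i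
  proof (rule equidist[where \<sigma>="\<lambda>m. tent_step (A * m) i" and c=\<kappa>])
    show "\<theta> m \<le> 1" for m
      using \<theta>_le[of m] n by (smt (verit) divide_le_eq_1)
    show "\<theta> m = \<kappa> m * (\<Prod>l\<in>UNIV. \<Sum>j<2 * A * m. (tent_step (A * m) i l j)\<^sup>2)" for m
      using prod_sum_tent_step_sq[of "A * m" i] by (simp add: \<theta>_def V_def mult.assoc)
    show "0 \<le> \<kappa> m" for m using V0[of m] by (simp add: \<kappa>_def)
  qed (use K in \<open>auto simp: K_def T_def mult.assoc\<close>)
  \<comment> \<open>Equidistribution sends these combined errors to 0, while the pointwise
    comparison of the kernels will keep them below a fixed negative number.\<close>
  define D where "D m = ((\<integral>x. f x * (1 / V m ^ CARD('n) * S m x) \<partial>\<mu>) - \<phi> m * integral\<^sup>L \<mu> f)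
      - (\<Sum>i\<in>UNIV. (\<integral>x. f x * (\<kappa> m * T i m x) \<partial>\<mu>) - \<theta> m * integral\<^sup>L \<mu> f)" for m
  have "D \<longlonglongrightarrow> 0 - (\<Sum>i\<in>(UNIV :: 'n set). 0)"
    unfolding D_def by (intro tendsto_diff tendsto_sum lim_S lim_T)
  then have "D \<longlonglongrightarrow> 0" by simp
  moreover have "D m \<le> - (integral\<^sup>L \<mu> f / 2)" if m: "m \<ge> 1" for m
  proof -
    have int_kernel: "integrable \<mu> (\<lambda>x. f x * (d * (norm (prod_kernel \<sigma> L q x))\<^sup>2))" for d \<sigma> L q
    proof (rule integrable_bounded_continuous[OF ps sets])
      show "continuous_on UNIV (\<lambda>x. f x * (d * (norm (prod_kernel \<sigma> L q x))\<^sup>2))"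
        using f(1) by (intro continuous_intros continuous_on_prod_kernel)
      show "norm (f x * (d * (norm (prod_kernel \<sigma> L q x))\<^sup>2)) \<le> r * (\<bar>d\<bar> * (\<Prod>i\<in>UNIV. \<Sum>j<L. \<bar>\<sigma> i j\<bar>)\<^sup>2)" for x
        unfolding norm_mult real_norm_def abs_mult abs_power2 using f(2)[of x] r
        by (intro mult_mono power_mono norm_prod_kernel_le) auto
    qed
    have "(\<integral>x. f x * (1 / V m ^ CARD('n) * S m x) \<partial>\<mu>) \<le> (\<integral>x. (\<Sum>i\<in>UNIV. f x * (\<kappa> m * T i m x)) \<partial>\<mu>)"
    proof (rule integral_mono_AE)
      show "integrable \<mu> (\<lambda>x. f x * (1 / V m ^ CARD('n) * S m x))"
        unfolding S_def by (rule int_kernel)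
      show "integrable \<mu> (\<lambda>x. \<Sum>i\<in>UNIV. f x * (\<kappa> m * T i m x))"
        unfolding T_def by (intro Bochner_Integration.integrable_sum int_kernel)
      show "AE x in \<mu>. f x * (1 / V m ^ CARD('n) * S m x) \<le> (\<Sum>i\<in>UNIV. f x * (\<kappa> m * T i m x))"
        using AE_K
      proof eventually_elim
        case (elim x)
        show ?case
        \<comment> \<open>In the ball the uniform constant applies; outside it the bump
          vanishes.\<close>
        proof (cases "x \<in> ball x0 r")
          case True
          have "16 * c\<^sup>2 / (real m)\<^sup>2 * S m x \<le> (\<Sum>i\<in>UNIV. T i m x)"
            unfolding S_def T_def using elim True sub m c
            by (intro Bad_const_kernel_le) (auto simp: c_def)
          then have "\<kappa> m * (16 * c\<^sup>2 / (real m)\<^sup>2 * S m x) \<le> \<kappa> m * (\<Sum>i\<in>UNIV. T i m x)"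
            using V0[of m] by (intro mult_left_mono) (auto simp: \<kappa>_def)
          also have "\<kappa> m * (16 * c\<^sup>2 / (real m)\<^sup>2 * S m x) = 1 / V m ^ CARD('n) * S m x"
            using m c V_pos[OF m] by (simp add: \<kappa>_def field_simps)
          finally have "f x * (1 / V m ^ CARD('n) * S m x) \<le> f x * (\<kappa> m * (\<Sum>i\<in>UNIV. T i m x))"
            by (intro mult_left_mono f0)
          then show ?thesis by (simp only: sum_distrib_left)
        next
          case False
          then have "f x = 0" by (simp add: f_def dist_commute)
          then show ?thesis by simp
        qed
      qed
    qed
    also have "\<dots> = (\<Sum>i\<in>UNIV. \<integral>x. f x * (\<kappa> m * T i m x) \<partial>\<mu>)"
      unfolding T_def by (intro Bochner_Integration.integral_sum int_kernel)
    finally have "D m \<le> (n * \<theta> m - \<phi> m) * integral\<^sup>L \<mu> f"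
      by (simp add: D_def sum_subtractf n_def algebra_simps)
    \<comment> \<open>For \<open>m \<ge> 1\<close> the \<open>n\<close> differenced weights have
      total mean at most 1/2, against mean 1 for the tent kernel.\<close>
    also have "\<dots> \<le> (- 1 / 2) * integral\<^sup>L \<mu> f"
    proof (rule mult_right_mono)
      have "n * \<theta> m \<le> n * (1 / (2 * n))"
        using n by (intro mult_left_mono \<theta>_le) auto
      then show "n * \<theta> m - \<phi> m \<le> - 1 / 2"
        using n V_pos[OF m] by (simp add: \<phi>_def)
    qed (use f_pos in simp)
    finally show ?thesis by simp
  qed
  ultimately have "0 \<le> - (integral\<^sup>L \<mu> f / 2)"
    by (intro LIMSEQ_le_const2) auto
  with f_pos show False by simp
qed

theorem theorem2:
  shows "fourier_dim (Bad :: (real ^ 'n) set)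
           \<le> ennreal (2 * real CARD('n) / (real CARD('n) + 1))"
  unfolding fourier_dim_def
proof (intro SUP_least ennreal_leI)
  fix \<mu> :: "(real ^ 'n) measure" assume \<mu>: "\<mu> \<in> compact_prob_measures Bad"
  then interpret prob_space \<mu> by (simp add: compact_prob_measures_def)
  \<comment> \<open>Hence the exponent 0 is admissible, which gives \<open>cSup_least\<close> its
    nonempty set.\<close>
  have "norm (fourier_transform \<mu> \<xi>) \<le> 1" for \<xi>
    unfolding fourier_transform_char_fun
    by (rule order_trans[OF integral_norm_bound]) (simp add: prob_space)
  then have 0: "0 \<in> {s \<in> {0..real CARD('n)}.
      \<exists>C. \<forall>\<xi>. \<xi> \<noteq> 0 \<longrightarrow> norm (fourier_transform \<mu> \<xi>) \<le> C * norm \<xi> powr (- s / 2)}"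
    by (auto intro!: exI[of _ 1])
  show "fourier_dim_measure \<mu> \<le> 2 * real CARD('n) / (real CARD('n) + 1)"
    unfolding fourier_dim_measure_def
  proof (rule cSup_least)
    fix s assume "s \<in> {s \<in> {0..real CARD('n)}.
      \<exists>C. \<forall>\<xi>. \<xi> \<noteq> 0 \<longrightarrow> norm (fourier_transform \<mu> \<xi>) \<le> C * norm \<xi> powr (- s / 2)}"
    then show "s \<le> 2 * real CARD('n) / (real CARD('n) + 1)"
      using fourier_decay_exponent_le[OF \<mu>] by auto
  qed (use 0 in blast)
qed

end
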